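(* Let $k\ge 0$ be an integer and let $G$ be an $n$-vertex graph with $\alpha'(G)=3k$ and $\alpha'_g(G)=2k$. Then $|E(G)|\le\binom{3k}{2}+3k(n-3k)$.
   Context: Graphs are finite and simple. $\alpha'(G)$ denotes the maximum size of a matching in $G$. The matching game on a graph $G$: two players, Max and Min, alternately add edges of $G$ to a set of chosen edges that must always remain a matching; the game ends when the chosen edges form a maximal matching of $G$ (no further edge can be added). Max wants the final matching to be large, Min wants it to be small. $\alpha'_g(G)$ denotes the size of the final matching under optimal play when Max moves first. *)

theory Defs
  imports Main
begin

text \<open>A graph is a vertex set \<open>V\<close> together with a set \<open>E\<close> of edges, an edge being
  the two-element set of its endpoints.\<close>

definition finite_simple_graph :: "'a set \<Rightarrow> 'a set set \<Rightarrow> bool" where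
  "finite_simple_graph V E \<longleftrightarrow> finite V \<and> (\<forall>e\<in>E. e \<subseteq> V \<and> card e = 2)"

definition matching :: "'a set set \<Rightarrow> 'a set set \<Rightarrow> bool" where
  "matching E M \<longleftrightarrow> M \<subseteq> E \<and> pairwise disjnt M"

definition matching_number :: "'a set set \<Rightarrow> nat" where
  "matching_number E = Max {card M | M. matching E M}"

datatype player = Maximizer | Minimizer

definition legal_moves :: "'a set set \<Rightarrow> 'a set set \<Rightarrow> 'a set set" where
  "legal_moves E M = {e \<in> E - M. matching E (insert e M)}"

text \<open>\<open>game_value E p M\<close> is the size of the final matching under optimal play from the position
  in which the edges of \<open>M\<close> have been chosen and player \<open>p\<close> is to move. The game ends exactly when
  no edge can be added, i.e. when \<open>M\<close> is a maximal matching. The disjunct \<open>infinite E\<close> only makes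
  the recursion total; it is irrelevant for finite graphs.\<close>

function game_value :: "'a set set \<Rightarrow> player \<Rightarrow> 'a set set \<Rightarrow> nat" where
  "game_value E p M =
     (if infinite E \<or> legal_moves E M = {} then card M
      else case p of
        Maximizer \<Rightarrow> (MAX e\<in>legal_moves E M. game_value E Minimizer (insert e M))
      | Minimizer \<Rightarrow> (MIN e\<in>legal_moves E M. game_value E Maximizer (insert e M)))"
  by pat_completeness auto
termination
proof (relation "measure (\<lambda>(E, p, M). card (E - M))", goal_cases)
  case 1
  show ?case by simp
next
  case (2 E p M e)
  then have "E - insert e M \<subset> E - M" "finite (E - M)"
    by (auto simp: legal_moves_def)
  then show ?case by (simp add: psubset_card_mono)
next
  case (3 E p M e)
  then have "E - insert e M \<subset> E - M" "finite (E - M)"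
    by (auto simp: legal_moves_def)
  then show ?case by (simp add: psubset_card_mono)
qed

declare game_value.simps [simp del]

definition game_matching_number :: "'a set set \<Rightarrow> nat" where
  "game_matching_number E = game_value E Maximizer {}"

end

theory Submission
  imports Defs
begin

text \<open>Always playing an edge of a maximum matching, Max loses at most three from the matching number in
  each round, so the final matching has at least two thirds of the maximum size. If exactly two thirds
  are reached, then every such move \<open>e\<close> of Max has a reply \<open>f\<close> after which the remaining graph is
  again extremal, with \<open>k - 1\<close> in place of \<open>k\<close>; by induction on \<open>k\<close> it suffices to choose \<open>e\<close> so that
  \<open>e \<union> f\<close> meets at least \<open>n - 3k - 1\<close> non-edges, where \<open>n\<close> counts the non-isolated vertices.

  If a non-isolated vertex \<open>v\<close> has degree at most \<open>3k\<close>, an edge at \<open>v\<close> will do. Otherwise, for any \<open>e\<close>, a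
  maximum matching after the reply leaves two non-adjacent vertices \<open>a, b\<close> uncovered, and a degree
  count forces both to have degree exactly \<open>3k + 1\<close> and to be adjacent to all of \<open>e \<union> f\<close>. Take such a
  vertex as \<open>v\<close> and let Max play an edge at \<open>v\<close>: this produces non-adjacent neighbours \<open>a, b\<close> of \<open>v\<close>.
  The move \<open>va\<close> then meets the \<open>n - 3k - 2\<close> non-edges at \<open>v\<close> and also the non-edge \<open>ab\<close>.\<close>

section \<open>Vertex deletion in an edge set, and neighbourhoods\<close>

definition delete_vertices :: "'a set set \<Rightarrow> 'a set \<Rightarrow> 'a set set" where
  "delete_vertices E W = {e \<in> E. disjnt e W}"

definition neighbours :: "'a set set \<Rightarrow> 'a \<Rightarrow> 'a set" where
  "neighbours E v = {w. {v, w} \<in> E}"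

lemma finite_simple_graph_finite: "finite_simple_graph V E \<Longrightarrow> finite E"
  by (rule finite_subset[of E "Pow V"]) (auto simp: finite_simple_graph_def)

lemma finite_simple_graph_Union:
  "finite_simple_graph V E \<Longrightarrow> finite_simple_graph (\<Union>E) E"
  by (auto simp: finite_simple_graph_def intro: finite_subset[of "\<Union>E" V])

lemma finite_simple_graph_delete:
  "finite_simple_graph V E \<Longrightarrow> finite_simple_graph V (delete_vertices E W)"
  by (auto simp: finite_simple_graph_def delete_vertices_def)

lemma finite_simple_graph_card2:
  "finite_simple_graph V E \<Longrightarrow> e \<in> E \<Longrightarrow> card e = 2"
  by (simp add: finite_simple_graph_def)

lemma finite_simple_graph_edge:
  assumes "finite_simple_graph V E" "e \<in> E"
  shows "finite e" "e \<noteq> {}"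
  using finite_simple_graph_card2[OF assms] by (auto intro: card_ge_0_finite)

lemma finite_simple_graph_empty_notin: "finite_simple_graph V E \<Longrightarrow> {} \<notin> E"
  using finite_simple_graph_edge(2) by blast

lemma delete_vertices_delete_vertices:
  "delete_vertices (delete_vertices E A) B = delete_vertices E (A \<union> B)"
  by (auto simp: delete_vertices_def disjnt_def)

lemma neighbours_delete:
  assumes "v \<notin> W"
  shows "neighbours (delete_vertices E W) v = neighbours E v - W"
  using assms by (auto simp: delete_vertices_def neighbours_def disjnt_def)

lemma neighbours_subset: "neighbours E v \<subseteq> \<Union>E"
  by (auto simp: neighbours_def)

lemma not_self_neighbour:
  "finite_simple_graph V E \<Longrightarrow> v \<notin> neighbours E v"
  by (auto simp: neighbours_def finite_simple_graph_def)

lemma edge_obtain: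
  assumes "finite_simple_graph V E" "e \<in> E" "v \<in> e"
  obtains u where "e = {v, u}" "u \<noteq> v"
  using finite_simple_graph_card2[OF assms(1,2)] assms(3) that by (auto simp: card_2_iff)

section \<open>Matchings and maximum matchings\<close>

lemma finite_matching: "finite E \<Longrightarrow> matching E M \<Longrightarrow> finite M"
  by (auto simp: matching_def intro: finite_subset)

lemma matching_subset: "matching E M \<Longrightarrow> N \<subseteq> M \<Longrightarrow> N \<subseteq> E' \<Longrightarrow> matching E' N"
  by (auto simp: matching_def intro: pairwise_subset)

lemma matching_insert:
  "matching E M \<Longrightarrow> e \<in> E \<Longrightarrow> disjnt e (\<Union>M) \<Longrightarrow> matching E (insert e M)"
  by (auto simp: matching_def pairwise_insert disjnt_def)

lemma finite_matching_cards:
  assumes "finite E"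
  shows "finite {card M | M. matching E M}"
proof -
  have "{card M | M. matching E M} \<subseteq> card ` Pow E"
    by (auto simp: matching_def)
  then show ?thesis
    using assms by (meson finite_Pow_iff finite_imageI finite_subset)
qed

lemma matching_card_le:
  "finite E \<Longrightarrow> matching E M \<Longrightarrow> card M \<le> matching_number E"
  unfolding matching_number_def by (rule Max_ge[OF finite_matching_cards]) auto

lemma maximum_matching_obtain:
  assumes "finite E"
  obtains M where "matching E M" "card M = matching_number E"
proof -
  have "matching E {}"
    by (simp add: matching_def)
  then have "matching_number E \<in> {card M | M. matching E M}"
    unfolding matching_number_def by (intro Max_in finite_matching_cards assms) auto
  then show ?thesis
    using that by auto
qed

lemma card_Union_matching:
  assumes "finite_simple_graph V E" "matching E M"
  shows "card (\<Union>M) = 2 * card M"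
proof -
  have "card (\<Union>M) = sum card M"
    using assms finite_simple_graph_edge(1)
    by (intro card_Union_disjoint) (auto simp: matching_def)
  also have "\<dots> = (\<Sum>e\<in>M. 2)"
    using assms by (intro sum.cong) (auto simp: matching_def finite_simple_graph_def)
  finally show ?thesis
    by simp
qed

text \<open>A vertex lies on at most one edge of a matching, so deleting \<open>W\<close> destroys
  at most \<open>card W\<close> edges of a maximum matching. For a move, \<open>card W = 2\<close>:
  it costs at most two.\<close>

lemma matching_number_delete_ge:
  assumes "finite E" "finite W"
  shows "matching_number E \<le> matching_number (delete_vertices E W) + card W"
proof -
  obtain M where M: "matching E M" "card M = matching_number E"
    using maximum_matching_obtain[OF assms(1)] by blast
  define N where "N = {e \<in> M. disjnt e W}"
  have "matching (delete_vertices E W) N"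
    using M(1) by (intro matching_subset[OF M(1)]) (auto simp: N_def delete_vertices_def matching_def)
  then have N: "card N \<le> matching_number (delete_vertices E W)"
    using assms(1) by (intro matching_card_le) (auto simp: delete_vertices_def)
  have "\<forall>e\<in>M - N. \<exists>w. w \<in> e \<inter> W"
    unfolding N_def disjnt_def by blast
  \<comment> \<open>Charging each destroyed edge to one of its vertices in \<open>W\<close> is
    injective, because matching edges are disjoint.\<close>
  then obtain h where h: "\<And>e. e \<in> M - N \<Longrightarrow> h e \<in> e \<inter> W"
    by metis
  have "inj_on h (M - N)"
  proof (rule inj_onI)
    fix e f assume ef: "e \<in> M - N" "f \<in> M - N" "h e = h f"
    have "h e \<in> e" "h e \<in> f"
      using h[OF ef(1)] h[OF ef(2)] ef(3) by auto
    then have "\<not> disjnt e f"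
      unfolding disjnt_def by blast
    then show "e = f"
      using M(1) ef(1,2) unfolding matching_def pairwise_def by blast
  qed
  moreover have "h ` (M - N) \<subseteq> W"
    using h by blast
  ultimately have "card (M - N) \<le> card W"
    using assms(2) by (rule card_inj_on_le)
  moreover have "card M = card N + card (M - N)"
  proof -
    have "N \<subseteq> M"
      by (auto simp: N_def)
    then show ?thesis
      using card_Int_Diff[OF finite_matching[OF assms(1) M(1)], of N] by (simp add: Int_absorb1)
  qed
  ultimately show ?thesis
    using N M(2) by linarith
qed

lemma maximum_matching_meets_edge:
  assumes "finite E" "{} \<notin> E" "matching E M" "card M = matching_number E" "e \<in> E"
  shows "\<not> disjnt e (\<Union>M)"
proof
  assume *: "disjnt e (\<Union>M)"
  obtain v where "v \<in> e"
    using assms(2,5) by fastforce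
  then have "e \<notin> M"
    using * unfolding disjnt_def by blast
  then have "card (insert e M) = Suc (card M)"
    using finite_matching[OF assms(1,3)] by simp
  then show False
    using matching_card_le[OF assms(1) matching_insert[OF assms(3,5) *]] assms(4) by simp
qed

text \<open>If \<open>p \<noteq> q\<close> are the ends of a matching edge with \<open>a\<close> adjacent to \<open>p\<close> and \<open>b\<close> adjacent
  to \<open>q\<close>, then \<open>a, p, q, b\<close> is an augmenting path.\<close>

lemma unmatched_degree_sum:
  assumes G: "finite_simple_graph V E"
    and M: "matching E M" "card M = matching_number E"
    and ab: "a \<noteq> b" "a \<notin> \<Union>M" "b \<notin> \<Union>M"
  shows "card (neighbours E a) + card (neighbours E b) \<le> 2 * card M"
proof -
  have fin: "finite E" "finite M"
    using finite_simple_graph_finite[OF G] finite_matching M(1) by auto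
  have ne: "{} \<notin> E"
    using finite_simple_graph_empty_notin[OF G] .
  have ME: "M \<subseteq> E" and dis: "pairwise disjnt M"
    using M(1) by (auto simp: matching_def)
  have finm: "finite m" if "m \<in> M" for m
    using that ME finite_simple_graph_edge(1)[OF G] by blast
  \<comment> \<open>By maximality, \<open>M\<close> covers every neighbour of an uncovered vertex,
    so the two degrees can be counted edge by edge along \<open>M\<close>.\<close>
  have nb: "neighbours E c \<subseteq> \<Union>M" if "c \<notin> \<Union>M" for c
  proof
    fix w assume "w \<in> neighbours E c"
    then have "{c, w} \<in> E"
      by (simp add: neighbours_def)
    then show "w \<in> \<Union>M"
      using maximum_matching_meets_edge[OF fin(1) ne M] that by (auto simp: disjnt_def)
  qed
  have split: "card (neighbours E c) = (\<Sum>m\<in>M. card (neighbours E c \<inter> m))" if "c \<notin> \<Union>M" for c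
  proof -
    have "neighbours E c = (\<Union>m\<in>M. neighbours E c \<inter> m)"
      using nb[OF that] by auto
    also have "card \<dots> = (\<Sum>m\<in>M. card (neighbours E c \<inter> m))"
      using fin finm dis by (intro card_UN_disjoint) (auto simp: pairwise_def disjnt_def)
    finally show ?thesis .
  qed
  have noaug: False
    if m: "m \<in> M" "p \<in> m" "q \<in> m" "p \<noteq> q" "p \<in> neighbours E a" "q \<in> neighbours E b" for m p q
  proof -
    have disU: "disjnt m (\<Union>(M - {m}))"
      using dis m(1) by (auto simp: pairwise_def disjnt_def)
    have 0: "matching E (M - {m})"
      using M(1) ME by (intro matching_subset[OF M(1)]) auto
    have e: "{a, p} \<in> E" "{b, q} \<in> E"
      using m by (auto simp: neighbours_def)
    have 1: "matching E (insert {a, p} (M - {m}))"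
      using e(1) disU m ab by (intro matching_insert[OF 0]) (auto simp: disjnt_def)
    have neq: "a \<noteq> q" "b \<noteq> p"
      using ab m by auto
    have 2: "matching E (insert {b, q} (insert {a, p} (M - {m})))"
      using e(2) disU m ab neq by (intro matching_insert[OF 1]) (auto simp: disjnt_def)
    have "{a, p} \<notin> M" "{b, q} \<notin> M" "{b, q} \<noteq> {a, p}"
      using ab neq by (auto simp: doubleton_eq_iff)
    then have "card (insert {b, q} (insert {a, p} (M - {m}))) = Suc (Suc (card (M - {m})))"
      using fin by simp
    also have "\<dots> = Suc (card M)"
      using card_Suc_Diff1[OF fin(2) m(1)] by simp
    finally show False
      using matching_card_le[OF fin(1) 2] M(2) by simp
  qed
  \<comment> \<open>Of the four possible adjacencies between \<open>a\<close>, \<open>b\<close> and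
    the ends \<open>p\<close>, \<open>q\<close>, the pairs \<open>ap\<close>, \<open>bq\<close> and
    \<open>aq\<close>, \<open>bp\<close> each exclude one another, so at most two occur.\<close>
  have "card (neighbours E a \<inter> m) + card (neighbours E b \<inter> m) \<le> 2" if "m \<in> M" for m
  proof -
    have "m \<in> E"
      using that ME by blast
    then obtain p q where m: "m = {p, q}" "p \<noteq> q"
      using finite_simple_graph_card2[OF G] unfolding card_2_iff by blast
    have "q \<notin> neighbours E b" if "p \<in> neighbours E a"
      using noaug[OF \<open>m \<in> M\<close>, of p q] m that by auto
    moreover have "p \<notin> neighbours E b" if "q \<in> neighbours E a"
      using noaug[OF \<open>m \<in> M\<close>, of q p] m that by auto
    ultimately show ?thesis
      using m by (cases "p \<in> neighbours E a"; cases "q \<in> neighbours E a";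
          cases "p \<in> neighbours E b"; cases "q \<in> neighbours E b") auto
  qed
  then have "(\<Sum>m\<in>M. card (neighbours E a \<inter> m) + card (neighbours E b \<inter> m)) \<le> (\<Sum>m\<in>M. 2)"
    by (intro sum_mono) auto
  then show ?thesis
    using split ab by (simp add: sum.distrib)
qed

text \<open>A maximum matching covers only twice the matching number of vertices, so two vertices of
  \<open>U\<close> stay uncovered. They are non-adjacent, since an edge between them would enlarge
  the matching.\<close>

lemma two_unmatched_vertices:
  assumes G: "finite_simple_graph V E" and "finite U"
    and "2 * matching_number E + 2 \<le> card U"
  obtains M a b where "matching E M" "card M = matching_number E" "a \<in> U" "b \<in> U" "a \<noteq> b"
    "a \<notin> \<Union>M" "b \<notin> \<Union>M" "{a, b} \<notin> E"
    "card (neighbours E a) + card (neighbours E b) \<le> 2 * matching_number E"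
proof -
  have fin: "finite E"
    using finite_simple_graph_finite[OF G] .
  obtain M where M: "matching E M" "card M = matching_number E"
    using maximum_matching_obtain[OF fin] by blast
  have "card U - card (\<Union>M) \<le> card (U - \<Union>M)"
    using card_Union_matching[OF G M(1)] finite_matching[OF fin M(1)] M(1)
      finite_simple_graph_edge(1)[OF G]
    by (intro diff_card_le_card_Diff finite_Union) (auto simp: matching_def)
  then have "2 \<le> card (U - \<Union>M)"
    using assms(3) card_Union_matching[OF G M(1)] M(2) by linarith
  then obtain T where "T \<subseteq> U - \<Union>M" "card T = 2"
    by (metis obtain_subset_with_card_n)
  then obtain a b where ab: "a \<in> U - \<Union>M" "b \<in> U - \<Union>M" "a \<noteq> b"
    by (auto simp: card_2_iff)
  have "{a, b} \<notin> E"
    using maximum_matching_meets_edge[OF fin finite_simple_graph_empty_notin[OF G] M, of "{a, b}"] ab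
    by (auto simp: disjnt_def)
  then show ?thesis
    using that[OF M, of a b] unmatched_degree_sum[OF G M] ab M(2) by auto
qed

subsection \<open>The game\<close>

lemma legal_moves_insert:
  assumes "e \<in> E" "e \<noteq> {}" "matching (delete_vertices E e) N"
  shows "legal_moves E (insert e N) = legal_moves (delete_vertices E e) N"
  using assms
  by (auto simp: legal_moves_def matching_def delete_vertices_def pairwise_insert disjnt_def)

text \<open>Choosing \<open>e\<close> turns the rest of the play into the game on the graph without
  the ends of \<open>e\<close>, with one edge already scored. The legal moves agree, and
  \<open>Suc\<close> commutes with \<open>Max\<close> and \<open>Min\<close> by monotonicity. This
  lets a game position be replaced by a fresh smaller graph.\<close>

lemma game_value_insert:
  assumes E: "finite E" "e \<in> E" "e \<noteq> {}"
  shows "matching (delete_vertices E e) N \<Longrightarrow>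
    game_value E p (insert e N) = Suc (game_value (delete_vertices E e) p N)"
proof (induction "card (delete_vertices E e - N)" arbitrary: N p rule: less_induct)
  case less
  define R where "R = delete_vertices E e"
  have N: "matching R N"
    using less.prems by (simp add: R_def)
  have fR: "finite R"
    using E by (simp add: R_def delete_vertices_def)
  have fN: "finite N"
    using finite_matching[OF fR N] .
  have "e \<notin> N"
    using N E by (auto simp: R_def matching_def delete_vertices_def disjnt_def)
  then have card: "card (insert e N) = Suc (card N)"
    using fN by simp
  define L where "L = legal_moves R N"
  have L: "legal_moves E (insert e N) = L"
    unfolding L_def R_def by (rule legal_moves_insert[OF E(2,3) less.prems])
  have fL: "finite L"
    using fR by (simp add: L_def legal_moves_def)
  have IH: "game_value E q (insert f (insert e N)) = Suc (game_value R q (insert f N))"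
    if "f \<in> L" for f q
  proof -
    have "R - insert f N \<subset> R - N" "matching R (insert f N)"
      using that by (auto simp: L_def legal_moves_def)
    then show ?thesis
      using less.hyps[of "insert f N" q] fR
      by (simp add: R_def psubset_card_mono insert_commute)
  qed
  have mono: "mono Suc"
    by (simp add: mono_def)
  show ?case
  proof (cases "L = {}")
    case True
    then show ?thesis
      using card L by (simp add: game_value.simps[of E p "insert e N"] game_value.simps[of R p N]
          flip: R_def L_def)
  next
    case False
    show ?thesis
    proof (cases p)
      case Maximizer
      have "(MAX f\<in>L. game_value E Minimizer (insert f (insert e N)))
          = (MAX f\<in>L. Suc (game_value R Minimizer (insert f N)))"
        using IH by (intro arg_cong[where f = Max] image_cong) auto
      also have "\<dots> = Suc (MAX f\<in>L. game_value R Minimizer (insert f N))"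
        using mono_Max_commute[OF mono, of "(\<lambda>f. game_value R Minimizer (insert f N)) ` L"] fL False
        by (simp add: image_image)
      finally show ?thesis
        using Maximizer L False E(1) fR
        by (simp add: game_value.simps[of E Maximizer "insert e N"] game_value.simps[of R Maximizer N]
            flip: R_def L_def)
    next
      case Minimizer
      have "(MIN f\<in>L. game_value E Maximizer (insert f (insert e N)))
          = (MIN f\<in>L. Suc (game_value R Maximizer (insert f N)))"
        using IH by (intro arg_cong[where f = Min] image_cong) auto
      also have "\<dots> = Suc (MIN f\<in>L. game_value R Maximizer (insert f N))"
        using mono_Min_commute[OF mono, of "(\<lambda>f. game_value R Maximizer (insert f N)) ` L"] fL False
        by (simp add: image_image)
      finally show ?thesis
        using Minimizer L False E(1) fR
        by (simp add: game_value.simps[of E Minimizer "insert e N"] game_value.simps[of R Minimizer N]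
            flip: R_def L_def)
    qed
  qed
qed

lemma legal_moves_empty: "legal_moves E {} = E"
  by (auto simp: legal_moves_def matching_def)

lemma game_value_singleton:
  assumes "finite E" "e \<in> E" "e \<noteq> {}"
  shows "game_value E p {e} = Suc (game_value (delete_vertices E e) p {})"
  using game_value_insert[OF assms, of "{}"] by (simp add: matching_def)

lemma game_value_Maximizer_ge:
  assumes "finite E" "e \<in> E" "e \<noteq> {}"
  shows "Suc (game_value (delete_vertices E e) Minimizer {}) \<le> game_value E Maximizer {}"
proof -
  have "game_value E Minimizer {e} \<le> (MAX f\<in>E. game_value E Minimizer {f})"
    using assms by (intro Max_ge) auto
  also have "\<dots> = game_value E Maximizer {}"
    using assms by (subst (2) game_value.simps) (auto simp: legal_moves_empty)
  finally show ?thesis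
    using game_value_singleton[OF assms] by simp
qed

lemma game_value_Minimizer_obtain:
  assumes "finite E" "E \<noteq> {}" "{} \<notin> E"
  obtains f where "f \<in> E"
    "game_value E Minimizer {} = Suc (game_value (delete_vertices E f) Maximizer {})"
proof -
  have "game_value E Minimizer {} = (MIN f\<in>E. game_value E Maximizer {f})"
    using assms by (subst game_value.simps) (auto simp: legal_moves_empty)
  moreover have "(MIN f\<in>E. game_value E Maximizer {f}) \<in> (\<lambda>f. game_value E Maximizer {f}) ` E"
    using assms by (intro Min_in) auto
  ultimately obtain f where "f \<in> E" "game_value E Minimizer {} = game_value E Maximizer {f}"
    by auto
  then show ?thesis
    using that game_value_singleton[OF assms(1), of f] assms(3) by metis
qed

section \<open>The two-thirds lower bound and replies that preserve equality\<close>

lemma matching_number_empty: "matching_number {} = 0"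
  by (simp add: matching_number_def matching_def)

text \<open>The matching without \<open>f\<close> survives the deletion of \<open>e\<close>. The
  edge \<open>e\<close> may be \<open>f\<close> itself or an edge outside \<open>M\<close> that
  touches \<open>M\<close> only in \<open>f\<close>.\<close>

lemma matching_number_delete_matched:
  assumes "finite E" "matching E M" "card M = matching_number E" "f \<in> M"
    and "disjnt e (\<Union>(M - {f}))"
  shows "matching_number E \<le> Suc (matching_number (delete_vertices E e))"
proof -
  have "matching (delete_vertices E e) (M - {f})"
    using assms(2,5)
    by (intro matching_subset[OF assms(2)]) (auto simp: matching_def delete_vertices_def disjnt_def)
  then have "card (M - {f}) \<le> matching_number (delete_vertices E e)"
    using assms(1) by (intro matching_card_le) (auto simp: delete_vertices_def)
  then show ?thesis
    using assms(3,4) finite_matching[OF assms(1,2)] by simp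
qed

text \<open>Max's edge lies in a maximum matching and costs one; Min's reply costs at most two. A
  full round thus scores two and lowers the matching number by at most three.\<close>

lemma game_matching_number_ge:
  "finite_simple_graph V E \<Longrightarrow> 2 * matching_number E \<le> 3 * game_matching_number E"
proof (induction "card E" arbitrary: E rule: less_induct)
  case less
  note G = less.prems
  have fin: "finite E"
    using finite_simple_graph_finite[OF G] .
  obtain M where M: "matching E M" "card M = matching_number E"
    using maximum_matching_obtain[OF fin] by blast
  show ?case
  proof (cases "M = {}")
    case True
    then show ?thesis
      using M by simp
  next
    case False
    then obtain e where e: "e \<in> M"
      by auto
    then have eE: "e \<in> E" "e \<noteq> {}"
      using M(1) finite_simple_graph_edge(2)[OF G] by (auto simp: matching_def)
    define F where "F = delete_vertices E e"
    have GF: "finite_simple_graph V F"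
      unfolding F_def by (rule finite_simple_graph_delete[OF G])
    have finF: "finite F"
      using finite_simple_graph_finite[OF GF] .
    have F: "matching_number E \<le> Suc (matching_number F)"
      unfolding F_def using M e
      by (intro matching_number_delete_matched[OF fin M e])
        (auto simp: matching_def pairwise_def disjnt_def)
    have gE: "Suc (game_value F Minimizer {}) \<le> game_value E Maximizer {}"
      unfolding F_def by (rule game_value_Maximizer_ge[OF fin eE])
    show ?thesis
    proof (cases "F = {}")
      case True
      then show ?thesis
        using F gE by (simp add: matching_number_empty game_matching_number_def)
    next
      case False
      then obtain f where f: "f \<in> F"
        "game_value F Minimizer {} = Suc (game_value (delete_vertices F f) Maximizer {})"
        using game_value_Minimizer_obtain[OF finF _ finite_simple_graph_empty_notin[OF GF]] by blast
      have "card f = 2"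
        using finite_simple_graph_card2[OF GF f(1)] .
      then have "matching_number F \<le> matching_number (delete_vertices F f) + 2"
        using matching_number_delete_ge[OF finF, of f] by (simp add: card_ge_0_finite)
      moreover have "delete_vertices F f \<subset> E"
        using f(1) finite_simple_graph_edge(2)[OF GF f(1)]
        by (auto simp: F_def delete_vertices_def disjnt_def)
      then have "2 * matching_number (delete_vertices F f) \<le>
          3 * game_matching_number (delete_vertices F f)"
        using less.hyps finite_simple_graph_delete[OF GF] fin by (simp add: psubset_card_mono)
      ultimately show ?thesis
        using F gE f(2) unfolding game_matching_number_def by linarith
    qed
  qed
qed

text \<open>After \<open>e\<close> and an optimal reply, the matching number is at least
  \<open>3 * j\<close> and the game value at most \<open>2 * j\<close>. The two-thirds bound for the
  remaining graph forces equality in both.\<close>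

lemma reply_obtain:
  assumes G: "finite_simple_graph V E"
    and k: "matching_number E = 3 * Suc j" "game_matching_number E = 2 * Suc j"
    and e: "e \<in> E" "matching_number E \<le> Suc (matching_number (delete_vertices E e))"
  obtains f where "f \<in> E" "disjnt e f"
    "matching_number (delete_vertices E (e \<union> f)) = 3 * j"
    "game_matching_number (delete_vertices E (e \<union> f)) = 2 * j"
proof -
  have fin: "finite E"
    using finite_simple_graph_finite[OF G] .
  define F where "F = delete_vertices E e"
  have GF: "finite_simple_graph V F"
    unfolding F_def by (rule finite_simple_graph_delete[OF G])
  have finF: "finite F"
    using finite_simple_graph_finite[OF GF] .
  have gE: "Suc (game_value F Minimizer {}) \<le> game_value E Maximizer {}"
    unfolding F_def by (rule game_value_Maximizer_ge[OF fin e(1) finite_simple_graph_edge(2)[OF G e(1)]])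
  have "F \<noteq> {}"
    using e(2) k(1) by (auto simp: matching_number_empty simp flip: F_def)
  then obtain f where f: "f \<in> F"
    "game_value F Minimizer {} = Suc (game_value (delete_vertices F f) Maximizer {})"
    using game_value_Minimizer_obtain[OF finF _ finite_simple_graph_empty_notin[OF GF]] by blast
  define R where "R = delete_vertices F f"
  have R: "R = delete_vertices E (e \<union> f)"
    by (simp add: R_def F_def delete_vertices_delete_vertices)
  have "card f = 2"
    using finite_simple_graph_card2[OF GF f(1)] .
  then have "matching_number F \<le> matching_number R + 2"
    using matching_number_delete_ge[OF finF, of f] by (simp add: card_ge_0_finite R_def)
  then have 1: "3 * j \<le> matching_number R"
    using e(2) k(1) by (simp flip: F_def)
  have 2: "game_matching_number R \<le> 2 * j"
    using gE f(2) k(2) by (simp add: R_def game_matching_number_def)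
  have 3: "2 * matching_number R \<le> 3 * game_matching_number R"
    using game_matching_number_ge[OF finite_simple_graph_delete[OF GF]] by (simp add: R_def)
  have "matching_number R = 3 * j" "game_matching_number R = 2 * j"
    using 1 2 3 by linarith+
  moreover have "f \<in> E" "disjnt e f"
    using f(1) by (auto simp: F_def delete_vertices_def disjnt_def)
  ultimately show ?thesis
    using that by (simp add: R)
qed

subsection \<open>Counting edges\<close>

text \<open>The target bound, as a function of \<open>n\<close> and \<open>k\<close>, grows by \<open>(4n - 10) - (n - 3k - 1)\<close> in a step
  from \<open>(n - 4, k - 1)\<close> to \<open>(n, k)\<close>, and \<open>4n - 10\<close> pairs of vertices meet a given set of size four.\<close>

lemma edge_bound_step:
  assumes G: "finite_simple_graph V E" and V: "card V = n" "6 * Suc j \<le> n"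
    and W: "W \<subseteq> V" "card W = 4"
    and R: "card (delete_vertices E W)
      \<le> (3 * j choose 2) + 3 * j * (card (\<Union>(delete_vertices E W)) - 3 * j)"
    and S: "\<And>p. p \<in> S \<Longrightarrow> p \<subseteq> V \<and> card p = 2 \<and> \<not> disjnt p W \<and> p \<notin> E"
    and card_S: "n \<le> card S + 3 * Suc j + 1"
  shows "card E \<le> (3 * Suc j choose 2) + 3 * Suc j * (n - 3 * Suc j)"
proof -
  define R' where "R' = delete_vertices E W"
  define P where "P U = {p. p \<subseteq> U \<and> card p = 2}" for U :: "'a set"
  have finV: "finite V"
    using G by (simp add: finite_simple_graph_def)
  have finP: "finite (P V)"
    using finV by (simp add: P_def)
  have P: "card (P U) = card U choose 2" if "U \<subseteq> V" for U
    unfolding P_def using that finV by (metis n_subsets finite_subset)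
  obtain d where d: "n = 6 * Suc j + d"
    using V(2) le_Suc_ex by blast
  \<comment> \<open>This is \<open>n - 4\<close>, the number of vertices outside \<open>W\<close>;
    writing it through \<open>d\<close> removes truncated subtraction from the final
    arithmetic.\<close>
  define m where "m = 6 * j + 2 + d"
  have nm: "n = m + 4"
    by (simp add: d m_def)
  have VW: "card (V - W) = m"
    using W V finV by (simp add: card_Diff_subset finite_subset nm)
  have "\<Union>R' \<subseteq> V - W"
    using G by (auto simp: R'_def delete_vertices_def finite_simple_graph_def disjnt_def)
  then have "card (\<Union>R') \<le> m"
    using VW finV by (metis card_mono finite_Diff)
  then have "card (\<Union>R') - 3 * j \<le> m - 3 * j"
    by simp
  then have cR: "card R' \<le> (3 * j choose 2) + 3 * j * (m - 3 * j)"
    using R mult_le_mono2[of _ _ "3 * j"] unfolding R'_def by (meson add_left_mono le_trans)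
  have sub: "R' \<subseteq> E" "finite E"
    using finite_simple_graph_finite[OF G] by (auto simp: R'_def delete_vertices_def)
  \<comment> \<open>The deleted edges and the non-edges in \<open>S\<close> are disjoint families of
    pairs meeting \<open>W\<close>, so together they number at most
    \<open>4 * m + 6\<close>.\<close>
  have "(E - R') \<union> S \<subseteq> P V - P (V - W)"
    using S G by (fastforce simp: P_def R'_def delete_vertices_def finite_simple_graph_def disjnt_def)
  moreover have "(E - R') \<inter> S = {}"
    using S by auto
  moreover have "finite S"
    using S finP by (intro finite_subset[of S "P V"]) (auto simp: P_def)
  ultimately have "card (E - R') + card S \<le> card (P V - P (V - W))"
    using finP sub by (metis card_Un_disjoint card_mono finite_Diff)
  also have "\<dots> = (n choose 2) - (m choose 2)"
    using P[of V] P[of "V - W"] V(1) VW finP finite_subset[OF _ finP, of "P (V - W)"]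
    by (subst card_Diff_subset) (auto simp: P_def)
  also have "\<dots> = 4 * m + 6"
    by (simp add: nm numeral_eq_Suc)
  finally have "card (E - R') + card S \<le> 4 * m + 6" .
  moreover have "3 * j * (m - 3 * j) = 9 * (j * j) + 6 * j + 3 * (j * d)"
    by (simp add: m_def algebra_simps)
  then have "card R' \<le> (3 * j choose 2) + (9 * (j * j) + 6 * j + 3 * (j * d))"
    using cR by simp
  moreover have "card E = card (E - R') + card R'"
    using sub by (metis add.commute card_Diff_subset card_mono finite_subset le_add_diff_inverse)
  moreover have "6 * j + d + 2 \<le> card S + 3 * j"
    using card_S d by simp
  ultimately have "card E \<le> ((3 * j choose 2) + 9 * j + 3)
      + (9 * (j * j) + 18 * j + 9 + 3 * (j * d) + 3 * d)"
    unfolding m_def by simp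
  moreover have "(3 * Suc j choose 2) = (3 * j choose 2) + 9 * j + 3"
    by (simp add: numeral_eq_Suc)
  moreover have "3 * Suc j * (n - 3 * Suc j) = 9 * (j * j) + 18 * j + 9 + 3 * (j * d) + 3 * d"
    by (simp add: d algebra_simps)
  ultimately show ?thesis
    by (simp only:)
qed

text \<open>This supplies the set \<open>S\<close> for \<open>edge_bound_step\<close>: a vertex of
  degree at most \<open>3 * Suc j\<close> already yields enough non-edges.\<close>

lemma nonedges_at_vertex:
  assumes G: "finite_simple_graph V E" and v: "v \<in> V"
  defines "S \<equiv> (\<lambda>w. {v, w}) ` (V - neighbours E v - {v})"
  shows "card S + card (neighbours E v) + 1 = card V"
    and "p \<in> S \<Longrightarrow> p \<subseteq> V \<and> card p = 2 \<and> v \<in> p \<and> p \<notin> E"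
proof -
  have fin: "finite V"
    using G by (simp add: finite_simple_graph_def)
  have sub: "insert v (neighbours E v) \<subseteq> V"
    using v G by (auto simp: neighbours_def finite_simple_graph_def)
  have "card S = card (V - insert v (neighbours E v))"
    unfolding S_def
    by (subst card_image) (auto simp: inj_on_def doubleton_eq_iff intro: arg_cong[where f = card])
  also have "\<dots> = card V - card (insert v (neighbours E v))"
    using fin sub by (meson card_Diff_subset finite_subset)
  also have "card (insert v (neighbours E v)) = Suc (card (neighbours E v))"
    using not_self_neighbour[OF G] fin sub by (metis card_insert_disjoint finite_insert finite_subset)
  finally show "card S + card (neighbours E v) + 1 = card V"
    using card_mono[OF fin sub] not_self_neighbour[OF G] fin sub
      card_insert_disjoint[of "neighbours E v" v]
    by (metis Suc_eq_plus1 add_Suc_right finite_insert finite_subset le_add_diff_inverse2)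
  show "p \<in> S \<Longrightarrow> p \<subseteq> V \<and> card p = 2 \<and> v \<in> p \<and> p \<notin> E"
    using v by (auto simp: S_def neighbours_def)
qed

text \<open>Every non-isolated vertex lies on an edge of some maximum matching, so Max can play
  there at a cost of one.\<close>

lemma maximum_matching_edge_obtain:
  assumes G: "finite_simple_graph V E" and v: "v \<in> \<Union>E"
  obtains e where "e \<in> E" "v \<in> e"
    "matching_number E \<le> Suc (matching_number (delete_vertices E e))"
proof -
  have fin: "finite E"
    using finite_simple_graph_finite[OF G] .
  obtain M where M: "matching E M" "card M = matching_number E"
    using maximum_matching_obtain[OF fin] by blast
  have dis: "disjnt e f" if "e \<in> M" "f \<in> M" "e \<noteq> f" for e f
    using that M(1) by (auto simp: matching_def pairwise_def)
  have ME: "M \<subseteq> E"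
    using M(1) by (simp add: matching_def)
  show ?thesis
  proof (cases "v \<in> \<Union>M")
    case True
    then obtain e where e: "e \<in> M" "v \<in> e"
      by auto
    then have "disjnt e (\<Union>(M - {e}))"
      using dis by (auto simp: disjnt_def)
    then show ?thesis
      using that e ME matching_number_delete_matched[OF fin M e(1)] by blast
  next
    case False
    \<comment> \<open>If \<open>M\<close> misses \<open>v\<close>, the other end \<open>u\<close> of
      any edge at \<open>v\<close> is covered by some \<open>f\<close> in \<open>M\<close>, and
      \<open>e\<close> can take the place of \<open>f\<close>.\<close>
    obtain e where e: "e \<in> E" "v \<in> e"
      using v by auto
    obtain u where u: "e = {v, u}" "u \<noteq> v"
      using edge_obtain[OF G e] .
    have "\<not> disjnt e (\<Union>M)"
      using maximum_matching_meets_edge[OF fin finite_simple_graph_empty_notin[OF G] M e(1)] .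
    then obtain f where f: "f \<in> M" "u \<in> f"
      using False u by (auto simp: disjnt_def)
    then have "disjnt e (\<Union>(M - {f}))"
      using dis[OF f(1)] False u by (auto simp: disjnt_def)
    then show ?thesis
      using that e matching_number_delete_matched[OF fin M f(1)] by blast
  qed
qed

text \<open>When all degrees are large, a reply that costs two matching edges leaves two unmatched vertices
  whose degrees attain equality in \<open>unmatched_degree_sum\<close>.\<close>

lemma dense_reply_obtain:
  assumes G: "finite_simple_graph (\<Union>E) E"
    and k: "matching_number E = 3 * Suc j" "game_matching_number E = 2 * Suc j"
    and deg: "\<forall>v\<in>\<Union>E. 3 * Suc j + 1 \<le> card (neighbours E v)"
    and e: "e \<in> E"
  obtains f a b where "f \<in> E" "disjnt e f"
    "matching_number (delete_vertices E (e \<union> f)) = 3 * j"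
    "game_matching_number (delete_vertices E (e \<union> f)) = 2 * j"
    "a \<in> \<Union>E" "b \<in> \<Union>E" "a \<noteq> b" "{a, b} \<notin> E" "e \<subseteq> neighbours E a" "e \<subseteq> neighbours E b"
    "card (neighbours E a) = 3 * Suc j + 1"
proof -
  have fin: "finite E" "finite (\<Union>E)"
    using finite_simple_graph_finite[OF G] G by (auto simp: finite_simple_graph_def)
  obtain M where M: "matching E M" "card M = matching_number E"
    using maximum_matching_obtain[OF fin(1)] by blast
  have "card (\<Union>M) \<le> card (\<Union>E)"
    using M(1) fin by (intro card_mono) (auto simp: matching_def)
  then have n: "6 * Suc j \<le> card (\<Union>E)"
    using card_Union_matching[OF G M(1)] M(2) k(1) by simp
  have finN: "finite (neighbours E v)" for v
    using neighbours_subset fin by (metis finite_subset)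
  have diff: "card (neighbours E v) \<le> card (neighbours (delete_vertices E W) v) + card W"
    if "v \<notin> W" "finite W" for v W
    using that diff_card_le_card_Diff[of W "neighbours E v"] neighbours_delete[OF that(1), of E] by simp
  have ce: "card e = 2" "finite e"
    using finite_simple_graph_card2[OF G e] by (auto simp: card_ge_0_finite)
  have e_sub: "e \<subseteq> \<Union>E"
    using e by auto
  \<comment> \<open>Here every edge costs at most one. Otherwise the matching number drops to at
    most \<open>3 * j + 1\<close>, and two uncovered vertices keep degree at least
    \<open>3 * j + 2\<close> each, exceeding the allowed sum \<open>6 * j + 2\<close>.\<close>
  have playable: "matching_number E \<le> Suc (matching_number (delete_vertices E e))"
  proof (rule ccontr)
    assume "\<not> ?thesis"
    then have mu: "matching_number (delete_vertices E e) \<le> 3 * j + 1"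
      using k(1) by simp
    have "card (\<Union>E - e) = card (\<Union>E) - 2"
      using ce e_sub by (simp add: card_Diff_subset)
    then have "2 * matching_number (delete_vertices E e) + 2 \<le> card (\<Union>E - e)"
      using mu n by simp
    then obtain a b where ab: "a \<in> \<Union>E - e" "b \<in> \<Union>E - e"
      "card (neighbours (delete_vertices E e) a) + card (neighbours (delete_vertices E e) b)
        \<le> 2 * matching_number (delete_vertices E e)"
      using two_unmatched_vertices[OF finite_simple_graph_delete[OF G], of "\<Union>E - e" e] fin
      by (metis finite_Diff)
    then show False
      using deg[rule_format, of a] deg[rule_format, of b] diff[of a e] diff[of b e] ce mu by auto
  qed
  obtain f where f: "f \<in> E" "disjnt e f"
    "matching_number (delete_vertices E (e \<union> f)) = 3 * j"
    "game_matching_number (delete_vertices E (e \<union> f)) = 2 * j"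
    using reply_obtain[OF G k e playable] .
  have cf: "card f = 2" "finite f"
    using finite_simple_graph_card2[OF G f(1)] by (auto simp: card_ge_0_finite)
  define W where "W = e \<union> f"
  have W: "card W = 4" "finite W" "W \<subseteq> \<Union>E"
    using ce cf f(1,2) e by (auto simp: W_def disjnt_def card_Un_disjoint)
  have "card (\<Union>E - W) = card (\<Union>E) - 4"
    using W by (simp add: card_Diff_subset)
  then have "2 * matching_number (delete_vertices E W) + 2 \<le> card (\<Union>E - W)"
    using f(3) n by (simp add: W_def)
  then obtain a b where ab: "a \<in> \<Union>E - W" "b \<in> \<Union>E - W" "a \<noteq> b" "{a, b} \<notin> delete_vertices E W"
    "card (neighbours (delete_vertices E W) a) + card (neighbours (delete_vertices E W) b) \<le> 6 * j"
    using two_unmatched_vertices[OF finite_simple_graph_delete[OF G], of "\<Union>E - W" W] fin f(3)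
    unfolding W_def[symmetric] by (metis finite_Diff mult.assoc mult_2 numeral_Bit0 mult_numeral_left_semiring_numeral)
  \<comment> \<open>Each degree is at least \<open>3 * j + 4\<close> and loses at most four to
    \<open>W\<close>, so at least \<open>3 * j\<close> remains. The sum is at most
    \<open>6 * j\<close>, hence every estimate is an equality.\<close>
  then have tight: "card (neighbours (delete_vertices E W) v) = 3 * j"
      "card (neighbours E v) = 3 * Suc j + 1" if "v = a \<or> v = b" for v
    using deg[rule_format, of a] deg[rule_format, of b] diff[of a W] diff[of b W] W that by auto
  \<comment> \<open>A loss of exactly four means that all four vertices of \<open>W\<close> are
    neighbours.\<close>
  have sub: "W \<subseteq> neighbours E v" if "v = a \<or> v = b" for v
  proof -
    have "v \<notin> W"
      using that ab by auto
    then have "card (neighbours E v - W) = 3 * j"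
      using tight(1)[OF that] neighbours_delete by metis
    then have "card (neighbours E v \<inter> W) = 4"
      using tight(2)[OF that] card_Int_Diff[OF finN[of v], of W] by simp
    then show ?thesis
      using W by (metis card_subset_eq inf.cobounded2 inf.absorb_iff2)
  qed
  have "{a, b} \<notin> E"
    using ab by (auto simp: delete_vertices_def disjnt_def)
  then show ?thesis
    using that[OF f] ab sub[of a] sub[of b] tight(2)[of a] by (auto simp: W_def)
qed

text \<open>Taking \<open>\<Union>E\<close> as vertex set excludes isolated vertices, so Max can
  play at any vertex of low degree. The remaining graph is again measured by its own non-isolated
  vertices, and the induction applies to it.\<close>

lemma edge_bound_Union:
  "finite_simple_graph (\<Union>E) E \<Longrightarrow> matching_number E = 3 * k \<Longrightarrow> game_matching_number E = 2 * k
    \<Longrightarrow> card E \<le> (3 * k choose 2) + 3 * k * (card (\<Union>E) - 3 * k)"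
proof (induction k arbitrary: E)
  case 0
  have "E = {}"
  proof (rule ccontr)
    assume "E \<noteq> {}"
    then obtain e where "e \<in> E"
      by auto
    then have "matching E {e}"
      by (simp add: matching_def)
    then show False
      using matching_card_le[OF finite_simple_graph_finite[OF 0(1)]] 0(2) by fastforce
  qed
  then show ?case
    by simp
next
  case (Suc j)
  note G = Suc.prems(1) and k = Suc.prems(2,3)
  define n where "n = card (\<Union>E)"
  have fin: "finite E" "finite (\<Union>E)"
    using finite_simple_graph_finite[OF G] G by (auto simp: finite_simple_graph_def)
  obtain M where M: "matching E M" "card M = matching_number E"
    using maximum_matching_obtain[OF fin(1)] by blast
  have "card (\<Union>M) \<le> n"
    unfolding n_def using M(1) fin by (intro card_mono) (auto simp: matching_def)
  then have n: "6 * Suc j \<le> n"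
    using card_Union_matching[OF G M(1)] M(2) k(1) by simp
  \<comment> \<open>Both cases below only have to provide a move \<open>e\<close>, a reply
    \<open>f\<close> that keeps the graph extremal, and enough non-edges \<open>S\<close> meeting
    \<open>e\<close>.\<close>
  have step: "card E \<le> (3 * Suc j choose 2) + 3 * Suc j * (n - 3 * Suc j)"
    if ef: "e \<in> E" "f \<in> E" "disjnt e f"
      and R: "matching_number (delete_vertices E (e \<union> f)) = 3 * j"
      "game_matching_number (delete_vertices E (e \<union> f)) = 2 * j"
      and S: "\<And>p. p \<in> S \<Longrightarrow> p \<subseteq> \<Union>E \<and> card p = 2 \<and> \<not> disjnt p e \<and> p \<notin> E"
      and card_S: "n \<le> card S + 3 * Suc j + 1"
    for e f S
  proof (rule edge_bound_step[OF G n_def[symmetric] n])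
    show "e \<union> f \<subseteq> \<Union>E"
      using ef by auto
    show "card (e \<union> f) = 4"
      using ef finite_simple_graph_card2[OF G]
      by (subst card_Un_disjoint) (auto simp: disjnt_def card_ge_0_finite)
    show "card (delete_vertices E (e \<union> f))
        \<le> (3 * j choose 2) + 3 * j * (card (\<Union>(delete_vertices E (e \<union> f))) - 3 * j)"
      by (rule Suc.IH[OF finite_simple_graph_Union[OF finite_simple_graph_delete[OF G]] R])
    show "p \<subseteq> \<Union>E \<and> card p = 2 \<and> \<not> disjnt p (e \<union> f) \<and> p \<notin> E" if "p \<in> S" for p
      using S[OF that] by (auto simp: disjnt_def)
    show "n \<le> card S + 3 * Suc j + 1"
      by (fact card_S)
  qed
  define nonedges where "nonedges v = (\<lambda>w. {v, w}) ` (\<Union>E - neighbours E v - {v})" for v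
  note card_nonedges = nonedges_at_vertex(1)[OF G, folded nonedges_def n_def]
    and nonedges = nonedges_at_vertex(2)[OF G, folded nonedges_def]
  show ?case
  proof (cases "\<exists>v\<in>\<Union>E. card (neighbours E v) \<le> 3 * Suc j")
    case True
    then obtain v where v: "v \<in> \<Union>E" "card (neighbours E v) \<le> 3 * Suc j"
      by blast
    obtain e where e: "e \<in> E" "v \<in> e"
      "matching_number E \<le> Suc (matching_number (delete_vertices E e))"
      using maximum_matching_edge_obtain[OF G v(1)] .
    obtain f where f: "f \<in> E" "disjnt e f"
      "matching_number (delete_vertices E (e \<union> f)) = 3 * j"
      "game_matching_number (delete_vertices E (e \<union> f)) = 2 * j"
      using reply_obtain[OF G k e(1,3)] .
    have "p \<subseteq> \<Union>E \<and> card p = 2 \<and> \<not> disjnt p e \<and> p \<notin> E" if "p \<in> nonedges v" for p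
      using nonedges[OF v(1) that] e(2) by (auto simp: disjnt_def)
    moreover have "n \<le> card (nonedges v) + 3 * Suc j + 1"
      using card_nonedges[OF v(1)] v(2) by linarith
    ultimately show ?thesis
      using step[OF e(1) f] unfolding n_def by blast
  next
    case False
    then have deg: "\<forall>v\<in>\<Union>E. 3 * Suc j + 1 \<le> card (neighbours E v)"
      by (metis Suc_eq_plus1 not_less_eq_eq)
    note reply = dense_reply_obtain[OF G k deg]
    have "E \<noteq> {}"
      using k(1) by (auto simp: matching_number_empty)
    then obtain e where "e \<in> E"
      by auto
    \<comment> \<open>A first move, at an arbitrary edge, serves only to exhibit a vertex of the
      exact minimum degree.\<close>
    then obtain v where v: "v \<in> \<Union>E" "card (neighbours E v) = 3 * Suc j + 1"
      using reply by metis
    then have "neighbours E v \<noteq> {}"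
      by auto
    then obtain u where "{v, u} \<in> E"
      by (auto simp: neighbours_def)
    \<comment> \<open>A second hypothetical move, now at \<open>v\<close>, yields two non-adjacent
      neighbours of \<open>v\<close>.\<close>
    then obtain a b where ab: "a \<in> \<Union>E" "b \<in> \<Union>E" "a \<noteq> b" "{a, b} \<notin> E"
      "v \<in> neighbours E a" "v \<in> neighbours E b"
      using reply[of "{v, u}"] by (metis insert_subset)
    then have va: "{v, a} \<in> E"
      by (simp add: neighbours_def insert_commute)
    obtain f where f: "f \<in> E" "disjnt {v, a} f"
      "matching_number (delete_vertices E ({v, a} \<union> f)) = 3 * j"
      "game_matching_number (delete_vertices E ({v, a} \<union> f)) = 2 * j"
      using reply[OF va] by metis
    \<comment> \<open>The non-edges at \<open>v\<close> fall one short of the required number. The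
      pair \<open>{a, b}\<close> makes up for it: it meets the move \<open>{v, a}\<close> but does
      not contain \<open>v\<close>.\<close>
    define S where "S = insert {a, b} (nonedges v)"
    have "p \<subseteq> \<Union>E \<and> card p = 2 \<and> \<not> disjnt p {v, a} \<and> p \<notin> E" if "p \<in> S" for p
      using nonedges[OF v(1), of p] that ab by (auto simp: S_def disjnt_def)
    moreover have "v \<noteq> a" "v \<noteq> b"
      using ab not_self_neighbour[OF G] by blast+
    then have "{a, b} \<notin> nonedges v"
      using nonedges[OF v(1), of "{a, b}"] by auto
    then have "card S = Suc (card (nonedges v))"
      using fin by (simp add: S_def nonedges_def)
    then have "n \<le> card S + 3 * Suc j + 1"
      using card_nonedges[OF v(1)] v(2) by linarith
    ultimately show ?thesis
      using step[OF va f] unfolding n_def by blast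
  qed
qed

theorem theorem3p11:
  fixes V :: "'a set" and E :: "'a set set" and n k :: nat
  assumes "finite_simple_graph V E"
    and "card V = n"
    and "matching_number E = 3 * k"
    and "game_matching_number E = 2 * k"
  shows "card E \<le> (3 * k choose 2) + 3 * k * (n - 3 * k)"
proof -
  \<comment> \<open>Isolated vertices can only increase the right-hand side.\<close>
  have "card (\<Union>E) \<le> n"
    using assms(1,2) by (auto simp: finite_simple_graph_def intro!: card_mono)
  then have "3 * k * (card (\<Union>E) - 3 * k) \<le> 3 * k * (n - 3 * k)"
    by (intro mult_le_mono2 diff_le_mono)
  then show ?thesis
    using edge_bound_Union[OF finite_simple_graph_Union[OF assms(1)] assms(3,4)] by linarith
qed

end
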